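(* Let $d\geq 3$. Then there exists $c>0$ such that the following holds. For every positive integer $k$, there exists a family of axis-parallel boxes in $\mathbb{R}^d$ containing at most $k$ pairwise disjoint sets and having piercing number at least $$ck\left(\frac{\log k}{\log\log k}\right)^{d-2}.$$
   Context: Boxes are closed axis-parallel boxes, i.e. sets of the form $\prod_{i=1}^d [a_i,b_i]$. The piercing number of a family $\mathcal{F}$ of sets is the minimum size of a set of points meeting every member of $\mathcal{F}$. The constant $c$ may depend on $d$ only. *)

theory Defs
  imports "HOL-Analysis.Analysis"
begin

text \<open>The condition \<open>a $ i \<le> b $ i\<close> makes every box nonempty: an empty box could not be met by any
  set of points.\<close>

definition axis_parallel_box :: "(real ^ 'd) set \<Rightarrow> bool" where
  "axis_parallel_box B \<longleftrightarrow> (\<exists>a b. (\<forall>i. a $ i \<le> b $ i) \<and> B = cbox a b)"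

text \<open>The value lies in \<^typ>\<open>enat\<close>, being \<open>\<infinity>\<close> if no finite set of points meets every member.\<close>

definition piercing_number :: "'a set set \<Rightarrow> enat" where
  "piercing_number F = (INF P \<in> {P. finite P \<and> (\<forall>B\<in>F. P \<inter> B \<noteq> {})}. enat (card P))"

text \<open>Infinite subfamilies must be excluded explicitly, since \<^const>\<open>card\<close> assigns them \<open>0\<close>.\<close>

definition at_most_pairwise_disjoint :: "nat \<Rightarrow> 'a set set \<Rightarrow> bool" where
  "at_most_pairwise_disjoint k F \<longleftrightarrow>
     (\<forall>G \<subseteq> F. pairwise disjnt G \<longrightarrow> finite G \<and> card G \<le> k)"

text \<open>Convention for \<open>ln k / ln (ln k)\<close> at small \<open>k\<close>: at \<open>k = 1\<close>, where \<open>ln (ln k)\<close> is not defined on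
  paper, the total functions of the library give \<open>0 / 0 = 0\<close>; at \<open>k = 2\<close> the quotient is a negative
  real, for which a power with natural exponent still makes sense.\<close>

end

theory Submission
  imports Defs "HOL-Real_Asymp.Real_Asymp"
begin

text \<open>
  Cut a \<open>d\<close>-dimensional lattice grid into \<open>b\<close>-adic blocks of a fixed volume \<open>s\<close>, in all shapes whose
  side lengths are \<open>b\<close>-powers with exponents below \<open>h\<close> (except in one direction). Every shape tiles
  the grid, so every point lies in exactly \<open>T = h ^ (d - 1)\<close> blocks, while two blocks of different
  shape share at most \<open>s / b\<close> points. Hence any subfamily covering the grid at least twice on average
  contains a block meeting at least \<open>b\<close> others. Branching on such a block bounds the generating
  function of the disjoint subfamilies, that is, the independence polynomial of the intersection graph.

  Now choose a sparse random set of blocks of density \<open>1 / u\<^sup>2\<close>, where \<open>u \<ge> T\<close> and \<open>b = u ^ 6\<close>. The first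
  moment method with that generating function shows that at most \<open>O(K)\<close> of them are pairwise
  disjoint, where \<open>K\<close> is \<open>1 / u\<^sup>2\<close> times the number of blocks of a single shape. A second union bound shows
  that no point lies in more than \<open>\<Delta> = O(h)\<close> of them. As there are \<open>T * K\<close> chosen blocks, at least
  \<open>T * K / \<Delta>\<close> points are needed, which beats \<open>K\<close> by a factor of order \<open>h ^ (d - 2)\<close>; and \<open>h\<close> can be
  taken of order \<open>ln k / ln (ln k)\<close>.
\<close>

section \<open>Disjoint subfamilies of a finite family\<close>

text \<open>Second moment of the multiplicities \<open>c x\<close>. If every member met fewer than
  \<open>b\<close> others, the bound \<open>s / b\<close> on intersections would keep the sum of
  \<open>card (B \<inter> C)\<close> over ordered pairs of distinct members below
  \<open>card S * s\<close>; convexity together with \<open>big\<close> forces at least that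
  much.\<close>

lemma exists_member_meeting_many:
  fixes S :: "'a set set"
  assumes fV: "finite V" and S: "S \<noteq> {}" "\<And>B. B \<in> S \<Longrightarrow> B \<subseteq> V" "\<And>B. B \<in> S \<Longrightarrow> card B = s"
    and s: "s > 0"
    and inter: "\<And>B C. B \<in> S \<Longrightarrow> C \<in> S \<Longrightarrow> B \<noteq> C \<Longrightarrow> b * card (B \<inter> C) \<le> s"
    and big: "2 * card V \<le> card S * s"
  shows "\<exists>B\<in>S. b \<le> card {C\<in>S. C \<noteq> B \<and> \<not> disjnt B C}"
proof (rule ccontr)
  define N where "N = (\<lambda>B. {C\<in>S. C \<noteq> B \<and> \<not> disjnt B C})"
  define c where "c = (\<lambda>x. card {B\<in>S. x \<in> B})"
  assume "\<not> ?thesis"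
  then have few: "card (N B) < b" if "B \<in> S" for B
    using that by (auto simp: N_def not_le)
  have fS: "finite S"
    using S(2) fV by (meson Pow_iff finite_Pow_iff finite_subset subsetI)
  have fB: "finite B" if "B \<in> S" for B
    using S(2) fV finite_subset that by blast
  have c1: "(\<Sum>x\<in>V. c x) = card S * s"
  proof -
    have "(\<Sum>x\<in>V. c x) = (\<Sum>x\<in>V. \<Sum>B\<in>S. if x \<in> B then 1 else 0)"
      using fS by (simp add: c_def sum.If_cases Int_def)
    also have "\<dots> = (\<Sum>B\<in>S. \<Sum>x\<in>V. if x \<in> B then 1 else 0)"
      by (rule sum.swap)
    also have "\<dots> = (\<Sum>B\<in>S. card B)"
      using S(2) fV by (intro sum.cong refl) (simp add: sum.If_cases Int_absorb1)
    finally show ?thesis using S(3) by simp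
  qed
  have c2: "(\<Sum>x\<in>V. c x * c x) = (\<Sum>B\<in>S. \<Sum>C\<in>S. card (B \<inter> C))"
  proof -
    have "(\<Sum>x\<in>V. c x * c x) = (\<Sum>x\<in>V. (\<Sum>B\<in>S. if x \<in> B then 1 else 0) * (\<Sum>C\<in>S. if x \<in> C then 1 else 0))"
      using fS by (simp add: c_def sum.If_cases Int_def)
    also have "\<dots> = (\<Sum>x\<in>V. \<Sum>B\<in>S. \<Sum>C\<in>S. if x \<in> B \<inter> C then 1 else 0)"
      unfolding sum_product by (intro sum.cong refl) auto
    also have "\<dots> = (\<Sum>B\<in>S. \<Sum>C\<in>S. \<Sum>x\<in>V. if x \<in> B \<inter> C then 1 else 0)"
      by (subst sum.swap, intro sum.cong refl, subst sum.swap) simp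
    also have "\<dots> = (\<Sum>B\<in>S. \<Sum>C\<in>S. card (B \<inter> C))"
    proof (intro sum.cong refl)
      fix B C assume "B \<in> S" "C \<in> S"
      then have "V \<inter> (B \<inter> C) = B \<inter> C" using S(2) by blast
      then show "(\<Sum>x\<in>V. if x \<in> B \<inter> C then 1 else 0) = card (B \<inter> C)"
        using fV by (simp add: sum.If_cases del: Int_iff)
    qed
    finally show ?thesis .
  qed
  have split: "(\<Sum>C\<in>S. card (B \<inter> C)) = s + (\<Sum>C\<in>N B. card (B \<inter> C))" if "B \<in> S" for B
  proof -
    have "(\<Sum>C\<in>S. card (B \<inter> C)) = card B + (\<Sum>C\<in>S - {B}. card (B \<inter> C))"
      using that fS by (simp add: sum.remove)
    also have "(\<Sum>C\<in>S - {B}. card (B \<inter> C)) = (\<Sum>C\<in>N B. card (B \<inter> C))"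
      by (rule sum.mono_neutral_right) (use fS in \<open>auto simp: N_def disjnt_def\<close>)
    finally show ?thesis using S(3)[OF that] by simp
  qed
  have "b * (\<Sum>B\<in>S. \<Sum>C\<in>N B. card (B \<inter> C)) = (\<Sum>B\<in>S. \<Sum>C\<in>N B. b * card (B \<inter> C))"
    by (simp add: sum_distrib_left)
  also have "\<dots> \<le> (\<Sum>B\<in>S. \<Sum>C\<in>N B. s)"
    by (intro sum_mono inter) (auto simp: N_def)
  also have "\<dots> = (\<Sum>B\<in>S. card (N B) * s)" by simp
  also have "\<dots> < (\<Sum>B\<in>S. b * s)"
    using few s by (intro sum_strict_mono fS S) auto
  finally have up: "(\<Sum>B\<in>S. \<Sum>C\<in>N B. card (B \<inter> C)) < card S * s"
    by (simp add: mult.left_commute)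
  \<comment> \<open>This is \<open>(c x - 1) * (c x - 2) \<ge> 0\<close> over the integers, freed of
    subtraction; equality at 1 and 2 makes it sharp enough for average multiplicity 2.\<close>
  have "3 * c x \<le> c x * c x + 2" for x
  proof -
    have "c x = 0 \<or> c x = 1 \<or> c x = 2 \<or> c x \<ge> 3" by arith
    then show ?thesis by (auto intro: le_trans[OF mult_le_mono1])
  qed
  then have "(\<Sum>x\<in>V. 3 * c x) \<le> (\<Sum>x\<in>V. c x * c x + 2)"
    by (intro sum_mono)
  then have "3 * (card S * s) \<le> (\<Sum>B\<in>S. \<Sum>C\<in>S. card (B \<inter> C)) + 2 * card V"
    by (simp only: sum.distrib c2 c1 sum_constant of_nat_id mult.commute[of _ 2] flip: sum_distrib_left)
  also have "(\<Sum>B\<in>S. \<Sum>C\<in>S. card (B \<inter> C)) = card S * s + (\<Sum>B\<in>S. \<Sum>C\<in>N B. card (B \<inter> C))"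
    by (simp add: split sum.distrib)
  finally show False using up big by linarith
qed

section \<open>Independence polynomial of the intersection graph\<close>

definition disjoint_poly :: "'a set set \<Rightarrow> real \<Rightarrow> real" where
  "disjoint_poly S x = (\<Sum>I | I \<subseteq> S \<and> pairwise disjnt I. x ^ card I)"

lemma disjoint_poly_le_power:
  assumes "finite S" "0 \<le> x"
  shows "disjoint_poly S x \<le> (1 + x) ^ card S"
proof -
  have "disjoint_poly S x \<le> (\<Sum>I\<in>Pow S. x ^ card I)"
    unfolding disjoint_poly_def using assms by (intro sum_mono2) auto
  also have "\<dots> = (\<Sum>I\<in>Pow S. (\<Prod>_\<in>I. x) * (\<Prod>_\<in>S - I. 1))" by simp
  also have "\<dots> = (\<Prod>_\<in>S. x + 1)"
    using assms by (simp only: prod_add)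
  finally show ?thesis by (simp add: add.commute)
qed

text \<open>Sort the disjoint subfamilies by whether they contain \<open>B\<close>; removing
  \<open>B\<close> from those that do costs one factor \<open>x\<close> and leaves only members
  disjoint from \<open>B\<close>.\<close>

lemma disjoint_poly_recursion:
  assumes fS: "finite S" and B: "B \<in> S" and x: "0 \<le> x"
  shows "disjoint_poly S x \<le> disjoint_poly (S - {B}) x + x * disjoint_poly {C\<in>S. C \<noteq> B \<and> disjnt B C} x"
proof -
  let ?D = "\<lambda>S. {I. I \<subseteq> S \<and> pairwise disjnt I}"
  let ?T = "{C\<in>S. C \<noteq> B \<and> disjnt B C}"
  have fin: "finite (?D S')" if "S' \<subseteq> S" for S'
    by (rule finite_subset[of _ "Pow S"]) (use fS that in auto)
  have sub: "?D S \<subseteq> ?D (S - {B}) \<union> insert B ` ?D ?T"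
  proof
    fix I assume I: "I \<in> ?D S"
    show "I \<in> ?D (S - {B}) \<union> insert B ` ?D ?T"
    proof (cases "B \<in> I")
      case True
      then have "I - {B} \<in> ?D ?T"
        using I by (auto simp: pairwise_def)
      moreover have "I = insert B (I - {B})" using True by auto
      ultimately show ?thesis by blast
    qed (use I in auto)
  qed
  have "disjoint_poly S x \<le> (\<Sum>I\<in>?D (S - {B}) \<union> insert B ` ?D ?T. x ^ card I)"
    unfolding disjoint_poly_def using sub fin x by (intro sum_mono2) auto
  also have "\<dots> = disjoint_poly (S - {B}) x + (\<Sum>I\<in>insert B ` ?D ?T. x ^ card I)"
    unfolding disjoint_poly_def using fin by (intro sum.union_disjoint) auto
  also have "(\<Sum>I\<in>insert B ` ?D ?T. x ^ card I) = (\<Sum>I\<in>?D ?T. x ^ card (insert B I))"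
  proof (subst sum.reindex)
    show "inj_on (insert B) (?D ?T)"
    proof (rule inj_onI)
      fix I J assume "I \<in> ?D ?T" "J \<in> ?D ?T" and eq: "insert B I = insert B J"
      then have "B \<notin> I" "B \<notin> J" by auto
      then show "I = J" using eq by (simp add: insert_ident)
    qed
  qed simp
  also have "\<dots> = (\<Sum>I\<in>?D ?T. x * x ^ card I)"
  proof (intro sum.cong refl)
    fix I assume I: "I \<in> ?D ?T"
    then have "finite I" using fS finite_subset[of I S] by auto
    moreover have "B \<notin> I" using I by auto
    ultimately show "x ^ card (insert B I) = x * x ^ card I" by simp
  qed
  also have "\<dots> = x * disjoint_poly ?T x"
    by (simp add: disjoint_poly_def sum_distrib_left)
  finally show ?thesis by simp
qed

text \<open>Branch on a member \<open>B\<close> of high degree: choosing \<open>B\<close> excludes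
  \<open>b\<close> further members, which shrinks the inductive bound by \<open>(1 + l) ^ b\<close>
  and so turns the weight \<open>x\<close> into at most \<open>l\<close>. Each removal costs only a
  factor \<open>1 + l\<close>, until at most \<open>R\<close> members remain and the trivial bound
  takes over.\<close>

lemma disjoint_poly_le:
  assumes fX: "finite X" and x: "0 \<le> x" and l: "0 \<le> l" "x \<le> l * (1 + l) ^ b"
    and deg: "\<And>S. S \<subseteq> X \<Longrightarrow> R < card S \<Longrightarrow> \<exists>B\<in>S. b \<le> card {C\<in>S. C \<noteq> B \<and> \<not> disjnt B C}"
    and "S \<subseteq> X"
  shows "disjoint_poly S x \<le> (1 + x) ^ R * (1 + l) ^ card S"
  using \<open>S \<subseteq> X\<close>
proof (induction "card S" arbitrary: S rule: less_induct)
  case less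
  have fS: "finite S" using less.prems fX finite_subset by blast
  show ?case
  proof (cases "R < card S")
    case False
    have "disjoint_poly S x \<le> (1 + x) ^ card S * 1"
      using disjoint_poly_le_power[OF fS x] by simp
    also have "\<dots> \<le> (1 + x) ^ R * (1 + l) ^ card S"
      using False x l by (intro mult_mono power_increasing one_le_power) auto
    finally show ?thesis .
  next
    case True
    then obtain B where B: "B \<in> S" and deg_B: "b \<le> card {C\<in>S. C \<noteq> B \<and> \<not> disjnt B C}"
      using deg less.prems by blast
    let ?T = "{C\<in>S. C \<noteq> B \<and> disjnt B C}" and ?N = "{C\<in>S. C \<noteq> B \<and> \<not> disjnt B C}"
    have "card (S - {B}) = card ?T + card ?N"
      using fS by (subst card_Un_disjoint[symmetric]) (auto intro!: arg_cong[of _ _ card])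
    then have cT: "card ?T + b \<le> card (S - {B})" using deg_B by simp
    have cS: "card S = Suc (card (S - {B}))" using B fS by (metis card.remove)
    let ?y = "(1 + x) ^ R"
    have y: "0 \<le> ?y" using x by simp
    have "disjoint_poly S x \<le> disjoint_poly (S - {B}) x + x * disjoint_poly ?T x"
      by (rule disjoint_poly_recursion[OF fS B x])
    also have "\<dots> \<le> ?y * (1 + l) ^ card (S - {B}) + x * (?y * (1 + l) ^ card ?T)"
      using less.prems cS cT x by (intro add_mono mult_left_mono less.hyps) auto
    also have "\<dots> = ?y * ((1 + l) ^ card (S - {B}) + x * (1 + l) ^ card ?T)"
      by (simp add: algebra_simps)
    also have "\<dots> \<le> ?y * ((1 + l) ^ card (S - {B}) + l * (1 + l) ^ card (S - {B}))"
    proof (intro mult_left_mono add_left_mono y)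
      have "x * (1 + l) ^ card ?T \<le> l * (1 + l) ^ b * (1 + l) ^ card ?T"
        using l by (intro mult_right_mono) auto
      also have "\<dots> = l * (1 + l) ^ (card ?T + b)" by (simp add: power_add mult.commute)
      also have "\<dots> \<le> l * (1 + l) ^ card (S - {B})"
        using cT l by (intro mult_left_mono power_increasing) auto
      finally show "x * (1 + l) ^ card ?T \<le> l * (1 + l) ^ card (S - {B})" .
    qed
    also have "\<dots> = ?y * (1 + l) ^ card S" by (simp add: cS algebra_simps)
    finally show ?thesis .
  qed
qed

section \<open>First moment method for subsets of fixed size\<close>

text \<open>The probability that a random \<open>m\<close>-subset of an \<open>N\<close>-set
  contains \<open>k\<close> given elements is the product of \<open>(m - i) / (N - i)\<close> for
  \<open>i < k\<close>, and no factor exceeds \<open>m / N\<close>.\<close>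

lemma binomial_diff_le:
  assumes "k \<le> m" "m \<le> N" "0 < N"
  shows "real ((N - k) choose (m - k)) \<le> (real m / real N) ^ k * real (N choose m)"
  using assms
proof (induction k arbitrary: m N)
  case (Suc k)
  then obtain m' N' where mN: "m = Suc m'" "N = Suc N'" by (metis Suc_le_D le_trans)
  show ?case
  proof (cases "N' = 0")
    case True
    then show ?thesis using Suc.prems mN by auto
  next
    case False
    have "real ((N - Suc k) choose (m - Suc k)) \<le> (real m' / real N') ^ k * real (N' choose m')"
      using Suc.IH[of m' N'] Suc.prems mN False by simp
    also have "\<dots> \<le> (real m / real N) ^ k * real (N' choose m')"
      using Suc.prems mN False by (intro mult_right_mono power_mono) (auto simp: field_simps)
    also have "real (N' choose m') = real m / real N * real (N choose m)"
    proof -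
      have "Suc m' * (Suc N' choose Suc m') = Suc N' * (N' choose m')"
        by (rule Suc_times_binomial)
      then have "real m * real (N choose m) = real N * real (N' choose m')"
        unfolding mN by (metis of_nat_mult)
      then show ?thesis using mN by (simp add: field_simps del: of_nat_Suc)
    qed
    finally show ?thesis by (simp add: mult_ac)
  qed
qed simp

text \<open>First moment bound for a uniformly random \<open>m\<close>-subset.\<close>

lemma exists_subset_avoiding:
  assumes fX: "finite X" and m: "m \<le> card X" "X \<noteq> {}"
    and H: "finite H" "\<And>I. I \<in> H \<Longrightarrow> I \<subseteq> X"
    and sum: "(\<Sum>I\<in>H. (real m / real (card X)) ^ card I) < 1"
  shows "\<exists>A\<subseteq>X. card A = m \<and> (\<forall>I\<in>H. \<not> I \<subseteq> A)"
proof (rule ccontr)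
  assume no: "\<not> ?thesis"
  let ?N = "card X"
  let ?C = "\<lambda>I. {A. A \<subseteq> X \<and> card A = m \<and> I \<subseteq> A}"
  have N: "0 < ?N" using fX m by (simp add: card_gt_0_iff)
  have cC: "real (card (?C I)) \<le> (real m / real ?N) ^ card I * real (?N choose m)" if "I \<in> H" for I
  proof (cases "card I \<le> m")
    case True
    have IX: "I \<subseteq> X" "finite I" using H(2)[OF that] fX finite_subset by auto
    have "bij_betw (\<lambda>A. A - I) (?C I) {A. A \<subseteq> X - I \<and> card A = m - card I}"
      using IX fX True
      by (intro bij_betwI[where g = "\<lambda>A. A \<union> I"])
        (auto simp: card_Diff_subset card_Un_disjoint finite_subset[OF _ fX] finite_subset[of _ "X - I"]
          Int_commute disjoint_iff intro!: card_Un_disjoint[THEN trans])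
    then have "card (?C I) = card {A. A \<subseteq> X - I \<and> card A = m - card I}"
      by (rule bij_betw_same_card)
    also have "\<dots> = (?N - card I) choose (m - card I)"
      using IX fX by (simp add: n_subsets card_Diff_subset)
    finally show ?thesis using binomial_diff_le[OF True m(1) N] by simp
  next
    case False
    have "I \<subseteq> A \<Longrightarrow> A \<subseteq> X \<Longrightarrow> card I \<le> card A" for A
      using fX by (meson card_mono finite_subset)
    then have "?C I = {}" using False by auto
    then show ?thesis by (simp only:) simp
  qed
  have "?N choose m = card {A. A \<subseteq> X \<and> card A = m}"
    using fX by (simp add: n_subsets)
  also have "\<dots> \<le> card (\<Union>I\<in>H. ?C I)"
  proof (rule card_mono)
    show "finite (\<Union>I\<in>H. ?C I)"
      by (rule finite_subset[of _ "Pow X"]) (use fX in auto)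
  qed (use no in auto)
  also have "\<dots> \<le> (\<Sum>I\<in>H. card (?C I))"
    by (rule card_UN_le[OF H(1)])
  finally have "real (?N choose m) \<le> real (\<Sum>I\<in>H. card (?C I))"
    by (rule of_nat_mono)
  also have "\<dots> = (\<Sum>I\<in>H. real (card (?C I)))" by (rule of_nat_sum)
  also have "\<dots> \<le> (\<Sum>I\<in>H. (real m / real ?N) ^ card I) * real (?N choose m)"
    unfolding sum_distrib_right by (intro sum_mono cC)
  also have "\<dots> < 1 * real (?N choose m)"
    using sum m(1) by (intro mult_strict_right_mono) auto
  finally show False by simp
qed

section \<open>A random subfamily\<close>

text \<open>Numerical margin for the threshold \<open>10 * K\<close>: the polynomial will be at most
  \<open>exp (17 * K)\<close>, rescaling gains \<open>8 ^ (10 * K)\<close>, and a factor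
  \<open>2 ^ K\<close> must be left over.\<close>

lemma exp_17_less: "2 * exp 17 < (8::real) ^ 10"
proof -
  have "exp (17::real) = exp 1 ^ 17"
    by (simp flip: exp_of_nat_mult)
  also have "\<dots> \<le> 3 ^ 17" by (intro power_mono exp_le) auto
  finally show ?thesis by simp
qed

text \<open>The members of \<open>X\<close> are selected with density \<open>1/u\<^sup>2\<close>. The threshold \<open>10 * K\<close> for disjoint
  subfamilies comes from evaluating the disjointness polynomial at \<open>8/u\<^sup>2\<close>.\<close>

lemma exists_sparse_subfamily:
  fixes X :: "'a set set"
  assumes fV: "finite V" and XV: "\<And>B. B \<in> X \<Longrightarrow> B \<subseteq> V" "\<And>B. B \<in> X \<Longrightarrow> card B = s" and s: "s > 0"
    and T: "\<And>x. x \<in> V \<Longrightarrow> card {B\<in>X. x \<in> B} = T" "0 < T" "T \<le> u"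
    and inter: "\<And>B C. B \<in> X \<Longrightarrow> C \<in> X \<Longrightarrow> B \<noteq> C \<Longrightarrow> u ^ 6 * card (B \<inter> C) \<le> s"
    and u: "3 \<le> u" and K: "0 < K" and V: "card V = u\<^sup>2 * K * s" and \<Delta>: "2 * card V < u ^ \<Delta>"
  obtains A where "A \<subseteq> X" "at_most_pairwise_disjoint (10 * K) A"
    "\<And>P. finite P \<Longrightarrow> \<forall>B\<in>A. P \<inter> B \<noteq> {} \<Longrightarrow> P \<subseteq> V \<Longrightarrow> T * K \<le> card P * \<Delta>"
proof -
  \<comment> \<open>As \<open>card V = M * s\<close>, it takes \<open>M\<close> members to tile
    \<open>V\<close> once; double counting gives \<open>card X = T * M\<close>, so
    \<open>T * K\<close> selected members have density exactly \<open>p\<close>.\<close>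
  define M where "M = u\<^sup>2 * K"
  define p where "p = 1 / real u ^ 2"
  have fX: "finite X"
    using XV(1) fV by (meson Pow_iff finite_Pow_iff finite_subset subsetI)
  have u0: "0 < real u" using u by simp
  have cX: "card X = T * M"
  proof -
    have "T * (M * s) = (\<Sum>x\<in>V. card {B\<in>X. x \<in> B})"
      using T(1) V by (simp add: M_def)
    also have "\<dots> = (\<Sum>B\<in>X. s)"
    proof (rule sum_multicount_gen[OF fV fX], intro ballI)
      fix B assume "B \<in> X"
      then have "{x\<in>V. x \<in> B} = B" using XV(1) by blast
      then show "card {x\<in>V. x \<in> B} = s" using XV(2) \<open>B \<in> X\<close> by simp
    qed
    finally show ?thesis using s by (simp flip: mult.assoc)
  qed
  have M: "0 < M" using u K by (simp add: M_def)
  then have X0: "X \<noteq> {}" using cX T(2) by auto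
  define m where "m = T * K"
  have mp: "real m / real (card X) = p"
    using cX T(2) K u0 by (simp add: m_def M_def p_def)
  have m_le: "m \<le> card X" using u by (simp add: cX m_def M_def)
  \<comment> \<open>The two kinds of forbidden configuration. Exact threshold sizes suffice, because
    disjointness and a common point both pass to subfamilies.\<close>
  define I1 where "I1 = {I. I \<subseteq> X \<and> pairwise disjnt I \<and> card I = 10 * K}"
  define I2 where "I2 = (\<Union>x\<in>V. {I. I \<subseteq> {B\<in>X. x \<in> B} \<and> card I = \<Delta>})"
  have fI: "finite I1" "finite I2"
    by (rule finite_subset[of _ "Pow X"], use fX in \<open>auto simp: I1_def I2_def\<close>)+
  have sum1: "(\<Sum>I\<in>I1. p ^ card I) < 1 / 2"
  proof -
    \<comment> \<open>By Bernoulli, \<open>?l * (1 + ?l) ^ (u ^ 6) \<ge> 1 \<ge> ?x\<close>, while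
      \<open>card X * ?l = K * T / u\<close> is at most \<open>K\<close>. Both at once are possible
      thanks to the exponent 6 in the intersection bound.\<close>
    let ?x = "8 * p" and ?l = "1 / real u ^ 3"
    have p: "0 < p" "?x \<le> 1"
    proof -
      have "9 \<le> real u ^ 2" using power_mono[of 3 "real u" 2] u by simp
      then show "?x \<le> 1" using u0 by (simp add: p_def divide_le_eq)
    qed (use u0 in \<open>simp add: p_def\<close>)
    have l: "?x \<le> ?l * (1 + ?l) ^ (u ^ 6)"
    proof -
      have "?x \<le> ?l * (real (u ^ 6) * ?l)"
        using p(2) u0 by (simp add: field_simps flip: power_add)
      also have "\<dots> \<le> ?l * (1 + real (u ^ 6) * ?l)"
        using u0 by (intro mult_left_mono) auto
      also have "\<dots> \<le> ?l * (1 + ?l) ^ (u ^ 6)"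
      proof (intro mult_left_mono Bernoulli_inequality)
        have "0 \<le> ?l" by simp
        then show "-1 \<le> ?l" by linarith
      qed simp
      finally show ?thesis .
    qed
    \<comment> \<open>More than \<open>2 * M\<close> members cover \<open>V\<close> more than twice
      on average, so branching can go on down to \<open>R = 2 * M\<close>.\<close>
    have deg: "\<exists>B\<in>S. u ^ 6 \<le> card {C\<in>S. C \<noteq> B \<and> \<not> disjnt B C}" if S: "S \<subseteq> X" "2 * M < card S" for S
    proof (rule exists_member_meeting_many[OF fV])
      show "2 * card V \<le> card S * s" using S(2) by (simp add: V flip: M_def)
      show "u ^ 6 * card (B \<inter> C) \<le> s" if "B \<in> S" "C \<in> S" "B \<noteq> C" for B C
        using inter[of B C] that S(1) by blast
    qed (use S XV s in auto)
    have "(\<Sum>I\<in>I1. ?x ^ card I) \<le> disjoint_poly X ?x"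
      unfolding disjoint_poly_def using p fX by (intro sum_mono2) (auto simp: I1_def)
    also have "\<dots> \<le> (1 + ?x) ^ (2 * M) * (1 + ?l) ^ card X"
      using p l u0 by (intro disjoint_poly_le[OF fX _ _ l deg]) auto
    also have "\<dots> \<le> exp ?x ^ (2 * M) * exp ?l ^ card X"
      using p u0 by (intro mult_mono power_mono exp_ge_add_one_self) auto
    also have "\<dots> = exp (real (2 * M) * ?x + real (card X) * ?l)"
      by (simp only: exp_of_nat_mult exp_add)
    \<comment> \<open>The first term of the exponent is \<open>16 * K\<close>, the second at most
      \<open>K\<close> because \<open>T \<le> u\<close>.\<close>
    also have "\<dots> \<le> exp (17 * real K)"
    proof -
      have "real (2 * M) * ?x = 16 * K" using u0 by (simp add: M_def p_def)
      moreover have "real (card X) * ?l = K * (T / u)"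
        using u0 by (simp add: cX M_def field_simps power2_eq_square power3_eq_cube)
      moreover have "K * (T / u) \<le> real K * 1"
        using T(3) u0 by (intro mult_left_mono) auto
      ultimately show ?thesis by simp
    qed
    finally have Z: "(\<Sum>I\<in>I1. ?x ^ card I) \<le> exp (17 * real K)" .
    \<comment> \<open>Every set in \<open>I1\<close> has \<open>10 * K\<close> elements, so passing
      from \<open>p\<close> to \<open>8 * p\<close> scales the sum by exactly
      \<open>8 ^ (10 * K)\<close>.\<close>
    have "8 ^ (10 * K) * (\<Sum>I\<in>I1. p ^ card I) = (\<Sum>I\<in>I1. ?x ^ card I)"
      by (simp add: sum_distrib_left I1_def power_mult_distrib)
    also note Z
    also have "exp (17 * real K) = exp 17 ^ K"
      by (simp add: mult.commute flip: exp_of_nat_mult)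
    also have "\<dots> < (8 ^ 10 / 2) ^ K"
      using exp_17_less K by (intro power_strict_mono) auto
    also have "\<dots> = 8 ^ (10 * K) * (1 / 2) ^ K"
      by (simp only: power_mult power_divide) simp
    also have "\<dots> \<le> 8 ^ (10 * K) * (1 / 2) ^ 1"
      using K by (intro mult_left_mono power_decreasing) auto
    finally show ?thesis by simp
  qed
  have sum2: "(\<Sum>I\<in>I2. p ^ card I) < 1 / 2"
  proof -
    \<comment> \<open>At most \<open>u ^ \<Delta>\<close> sets per point, each of weight
      \<open>1 / u ^ (2 * \<Delta>)\<close>, leave \<open>card V / u ^ \<Delta>\<close>; hence the
      assumption on \<open>\<Delta>\<close>.\<close>
    have "card I2 \<le> (\<Sum>x\<in>V. card {I. I \<subseteq> {B\<in>X. x \<in> B} \<and> card I = \<Delta>})"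
      unfolding I2_def by (rule card_UN_le[OF fV])
    also have "\<dots> = (\<Sum>x\<in>V. T choose \<Delta>)"
      using fX T(1) by (intro sum.cong refl) (simp add: n_subsets)
    also have "\<dots> \<le> (\<Sum>x\<in>V. u ^ \<Delta>)"
    proof (intro sum_mono)
      have "T choose \<Delta> \<le> T ^ \<Delta>" by (cases "\<Delta> \<le> T") (auto intro: binomial_le_pow simp: binomial_eq_0)
      also have "\<dots> \<le> u ^ \<Delta>" using T(3) by (intro power_mono) auto
      finally show "T choose \<Delta> \<le> u ^ \<Delta>" .
    qed
    finally have cI2: "card I2 \<le> card V * u ^ \<Delta>" by simp
    have "(\<Sum>I\<in>I2. p ^ card I) = real (card I2) * p ^ \<Delta>"
      by (simp add: I2_def)
    also have "\<dots> \<le> real (card V * u ^ \<Delta>) * p ^ \<Delta>"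
      using cI2 by (intro mult_right_mono of_nat_mono) (auto simp: p_def)
    also have "\<dots> = card V / real u ^ \<Delta>"
      using u0 by (simp add: p_def power_divide flip: power_mult power_add) (simp add: mult_2 power_add)
    also have "\<dots> < 1 / 2"
    proof -
      have "2 * real (card V) < real u ^ \<Delta>"
        using \<Delta> by (metis of_nat_less_iff of_nat_mult of_nat_numeral of_nat_power)
      then show ?thesis using u0 by (simp add: field_simps)
    qed
    finally show ?thesis .
  qed
  have "(\<Sum>I\<in>I1 \<union> I2. p ^ card I) \<le> (\<Sum>I\<in>I1. p ^ card I) + (\<Sum>I\<in>I2. p ^ card I)"
    using fI by (subst sum.union_inter[symmetric]) (auto intro!: sum_nonneg simp: p_def)
  also have "\<dots> < 1" using sum1 sum2 by simp
  finally have sum12: "(\<Sum>I\<in>I1 \<union> I2. (real m / real (card X)) ^ card I) < 1" by (simp only: mp)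
  then obtain A where A: "A \<subseteq> X" "card A = m" and avoid: "\<And>I. I \<in> I1 \<union> I2 \<Longrightarrow> \<not> I \<subseteq> A"
  proof -
    have "I \<subseteq> X" if "I \<in> I1 \<union> I2" for I using that by (auto simp: I1_def I2_def)
    then show ?thesis
      using exists_subset_avoiding[OF fX m_le X0, of "I1 \<union> I2"] fI that sum12 by blast
  qed
  have fA: "finite A" using A fX finite_subset by blast
  show thesis
  proof
    show "A \<subseteq> X" by (rule A)
    show "at_most_pairwise_disjoint (10 * K) A"
      unfolding at_most_pairwise_disjoint_def
    proof (intro allI impI conjI)
      fix G assume G: "G \<subseteq> A" "pairwise disjnt G"
      then show "finite G" using fA finite_subset by blast
      show "card G \<le> 10 * K"
      proof (rule ccontr)
        assume "\<not> ?thesis"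
        then obtain H where H: "H \<subseteq> G" "card H = 10 * K"
          by (meson nat_le_linear obtain_subset_with_card_n)
        then have "H \<in> I1" using G A by (auto simp: I1_def intro: pairwise_subset)
        then show False using avoid[of H] H G by auto
      qed
    qed
    fix P assume P: "finite P" "\<forall>B\<in>A. P \<inter> B \<noteq> {}" "P \<subseteq> V"
    have "card {B\<in>A. x \<in> B} \<le> \<Delta>" if "x \<in> V" for x
    proof (rule ccontr)
      assume "\<not> ?thesis"
      then obtain H where H: "H \<subseteq> {B\<in>A. x \<in> B}" "card H = \<Delta>"
        by (meson nat_le_linear obtain_subset_with_card_n)
      then have "H \<in> I2" using that A by (auto simp: I2_def)
      then show False using avoid[of H] H by auto
    qed
    then have "(\<Sum>x\<in>P. card {B\<in>A. x \<in> B}) \<le> (\<Sum>x\<in>P. \<Delta>)"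
      using P(3) by (intro sum_mono) auto
    moreover have "card A \<le> card (\<Union>x\<in>P. {B\<in>A. x \<in> B})"
      using P fA by (intro card_mono) auto
    moreover have "\<dots> \<le> (\<Sum>x\<in>P. card {B\<in>A. x \<in> B})"
      by (rule card_UN_le[OF P(1)])
    ultimately show "T * K \<le> card P * \<Delta>" using A(2) by (simp add: m_def)
  qed
qed

section \<open>Blocks of a lattice grid\<close>

text \<open>Given as an equivalence class, a \<open>b\<close>-adic cell can be named by any of its
  points, and the cells of one shape form a partition.\<close>

definition block :: "nat \<Rightarrow> ('d \<Rightarrow> nat) \<Rightarrow> ('d \<Rightarrow> nat) \<Rightarrow> ('d \<Rightarrow> nat) set" where
  "block b f x = {y. \<forall>j. y j div b ^ f j = x j div b ^ f j}"

lemma block_eq_PiE: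
  assumes "0 < b"
  shows "block b f x = (\<Pi>\<^sub>E j\<in>UNIV. {x j div b ^ f j * b ^ f j ..< x j div b ^ f j * b ^ f j + b ^ f j})"
proof -
  have "y div c = q \<longleftrightarrow> q * c \<le> y \<and> y < q * c + c" if "0 < c" for y c q :: nat
  proof
    assume "y div c = q"
    then have "y = q * c + y mod c" using div_mult_mod_eq[of y c] by simp
    moreover have "y mod c < c" using that by simp
    ultimately show "q * c \<le> y \<and> y < q * c + c" by linarith
  qed (auto intro: div_nat_eqI simp: mult.commute)
  then show ?thesis
    using assms by (auto simp: block_def PiE_UNIV_domain)
qed

lemma card_block:
  fixes f :: "'d::finite \<Rightarrow> nat"
  assumes "0 < b"
  shows "finite (block b f x)" "card (block b f x) = b ^ (\<Sum>j\<in>UNIV. f j)"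
  using assms by (simp_all add: block_eq_PiE finite_PiE card_PiE power_sum)

lemma mem_block: "x \<in> block b f x"
  by (simp add: block_def)

lemma block_eqI: "y \<in> block b f x \<Longrightarrow> block b f y = block b f x"
  by (simp add: block_def)

text \<open>Cells of one shape are equal or disjoint. Cells of different shapes through
  \<open>z\<close> meet inside the cell of shape \<open>min (f j) (g j)\<close> at \<open>z\<close>,
  and equal exponent sums force that minimum to have a smaller sum. The alternative
  \<open>f \<noteq> g\<close> in \<open>ne\<close> admits cells not yet known to differ.\<close>

lemma card_block_Int:
  fixes f g :: "'d::finite \<Rightarrow> nat"
  assumes b: "0 < b" and sum: "(\<Sum>j\<in>UNIV. f j) = n" "(\<Sum>j\<in>UNIV. g j) = n"
    and ne: "block b f x \<noteq> block b g y \<or> f \<noteq> g"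
  shows "b * card (block b f x \<inter> block b g y) \<le> b ^ n"
proof (cases "block b f x \<inter> block b g y = {}")
  case False
  then obtain z where z: "block b f x = block b f z" "block b g y = block b g z"
    using block_eqI by blast
  have "\<exists>j. g j < f j"
  proof (rule ccontr)
    assume "\<not> ?thesis"
    then have le: "f j \<le> g j" for j by (meson not_le)
    have "f j = g j" for j
    proof (rule ccontr)
      assume "f j \<noteq> g j"
      then have "(\<Sum>j\<in>UNIV. f j) < (\<Sum>j\<in>UNIV. g j)"
        using le by (intro sum_strict_mono_ex1) (auto simp: order_less_le)
      then show False using sum by simp
    qed
    then have "f = g" by auto
    then show False using ne z by auto
  qed
  then have "(\<Sum>j\<in>UNIV. min (f j) (g j)) < (\<Sum>j\<in>UNIV. f j)"
    by (intro sum_strict_mono_ex1) (auto simp: min_less_iff_disj)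
  then have "(\<Sum>j\<in>UNIV. min (f j) (g j)) < n" using sum by simp
  moreover have "block b f z \<inter> block b g z \<subseteq> block b (\<lambda>j. min (f j) (g j)) z"
    by (auto simp: block_def min_def)
  then have "card (block b f z \<inter> block b g z) \<le> b ^ (\<Sum>j\<in>UNIV. min (f j) (g j))"
    using card_block[OF b] by (metis card_mono)
  moreover have "b ^ (\<Sum>j\<in>UNIV. min (f j) (g j)) \<le> b ^ (n - 1)"
    using b \<open>(\<Sum>j\<in>UNIV. min (f j) (g j)) < n\<close> by (intro power_increasing) auto
  ultimately have "b * card (block b f z \<inter> block b g z) \<le> b * b ^ (n - 1)"
    by (intro mult_left_mono) auto
  also have "\<dots> = b ^ n"
    using \<open>(\<Sum>j\<in>UNIV. min (f j) (g j)) < n\<close> by (cases n) auto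
  finally show ?thesis by (simp add: z)
qed simp

text \<open>The exponent at \<open>j0\<close> absorbs whatever the others leave of \<open>n\<close>,
  so that all shapes share the volume \<open>b ^ n\<close>.\<close>

definition shapes :: "'d \<Rightarrow> nat \<Rightarrow> nat \<Rightarrow> ('d::finite \<Rightarrow> nat) set" where
  "shapes j0 h n = {f. (\<Sum>j\<in>UNIV. f j) = n \<and> (\<forall>j. j \<noteq> j0 \<longrightarrow> f j < h)}"

text \<open>The exponents away from \<open>j0\<close> can be chosen freely below \<open>h\<close>
  and determine the shape; the bound on \<open>n\<close> makes the remainder left for
  \<open>j0\<close> a genuine difference.\<close>

lemma card_shapes:
  fixes j0 :: "'d::finite"
  assumes n: "(CARD('d) - 1) * h \<le> n"
  shows "card (shapes j0 h n) = h ^ (CARD('d) - 1)"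
proof -
  let ?U = "UNIV - {j0}"
  have split: "(\<Sum>j\<in>UNIV. f j) = f j0 + (\<Sum>j\<in>?U. f j)" for f :: "'d \<Rightarrow> nat"
    by (rule sum.remove) auto
  have le: "(\<Sum>j\<in>?U. g j) \<le> n" if "\<And>j. j \<noteq> j0 \<Longrightarrow> g j < h" for g :: "'d \<Rightarrow> nat"
  proof -
    have "(\<Sum>j\<in>?U. g j) \<le> (\<Sum>j\<in>?U. h)"
      using that by (intro sum_mono) (auto intro: less_imp_le)
    then show ?thesis using n by (simp add: card_Diff_subset)
  qed
  have "bij_betw (\<lambda>f. restrict f ?U) (shapes j0 h n) (?U \<rightarrow>\<^sub>E {..<h})"
  proof (rule bij_betwI[where g = "\<lambda>g j. if j = j0 then n - (\<Sum>i\<in>?U. g i) else g j"])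
    show "(\<lambda>f. restrict f ?U) \<in> shapes j0 h n \<rightarrow> (?U \<rightarrow>\<^sub>E {..<h})"
      by (auto simp: shapes_def)
    show "(\<lambda>g j. if j = j0 then n - (\<Sum>i\<in>?U. g i) else g j) \<in> (?U \<rightarrow>\<^sub>E {..<h}) \<rightarrow> shapes j0 h n"
    proof
      fix g assume g: "g \<in> ?U \<rightarrow>\<^sub>E {..<h}"
      then have "(\<Sum>j\<in>?U. g j) \<le> n" by (intro le) (auto simp: PiE_def Pi_def)
      moreover have "(\<Sum>j\<in>?U. if j = j0 then m else g j) = (\<Sum>j\<in>?U. g j)" for m
        by (intro sum.cong) auto
      ultimately show "(\<lambda>j. if j = j0 then n - (\<Sum>i\<in>?U. g i) else g j) \<in> shapes j0 h n"
        using g by (auto simp: shapes_def split PiE_def Pi_def)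
    qed
    show "(\<lambda>j. if j = j0 then n - (\<Sum>i\<in>?U. restrict f ?U i) else restrict f ?U j) = f"
      if "f \<in> shapes j0 h n" for f
    proof -
      have "(\<Sum>i\<in>?U. restrict f ?U i) = (\<Sum>i\<in>?U. f i)" by (intro sum.cong) auto
      then show ?thesis using that split[of f] by (auto simp: shapes_def fun_eq_iff)
    qed
    show "restrict (\<lambda>j. if j = j0 then n - (\<Sum>i\<in>?U. g i) else g j) ?U = g"
      if "g \<in> ?U \<rightarrow>\<^sub>E {..<h}" for g
      using that by (auto simp: fun_eq_iff PiE_def extensional_def)
  qed
  then have "card (shapes j0 h n) = card (?U \<rightarrow>\<^sub>E {..<h})"
    by (rule bij_betw_same_card)
  then show ?thesis by (simp add: card_PiE card_Diff_subset)
qed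

text \<open>Stretching one direction by \<open>q\<close> multiplies the number of cells of each
  shape by an arbitrary factor, which later fits the construction to any large
  \<open>k\<close>.\<close>

definition grid :: "'d \<Rightarrow> nat \<Rightarrow> nat \<Rightarrow> ('d \<Rightarrow> nat) set" where
  "grid j0 q L = {x. \<forall>j. x j < (if j = j0 then q * L else L)}"

lemma card_grid:
  fixes j0 :: "'d::finite"
  shows "finite (grid j0 q L)" "card (grid j0 q L) = q * L ^ CARD('d)"
proof -
  have eq: "grid j0 q L = (\<Pi>\<^sub>E j\<in>UNIV. {..< if j = j0 then q * L else L})"
    by (auto simp: grid_def PiE_UNIV_domain Pi_def)
  then show "finite (grid j0 q L)" by (simp add: finite_PiE)
  have "card (grid j0 q L) = (\<Prod>j\<in>UNIV. if j = j0 then q * L else L)"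
    by (simp add: eq card_PiE)
  also have "\<dots> = q * L * (\<Prod>j\<in>UNIV - {j0}. L)"
    by (subst prod.remove[of _ j0]) auto
  also have "\<dots> = q * L ^ Suc (CARD('d) - 1)"
    by (simp add: card_Diff_subset del: Suc_pred)
  finally show "card (grid j0 q L) = q * L ^ CARD('d)" by simp
qed

text \<open>No cell sticks out: as \<open>f j \<le> n\<close>, each side of the grid is a multiple
  of \<open>b ^ f j\<close>.\<close>

lemma block_subset_grid:
  assumes b: "0 < b" and f: "\<And>j. f j \<le> n" and x: "x \<in> grid j0 q (b ^ n)"
  shows "block b f x \<subseteq> grid j0 q (b ^ n)"
proof
  fix y assume y: "y \<in> block b f x"
  have "y j < (if j = j0 then q * b ^ n else b ^ n)" for j
  proof -
    define t where "t = (if j = j0 then q else 1)"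
    have L: "(if j = j0 then q * b ^ n else b ^ n) = t * b ^ (n - f j) * b ^ f j"
      using f[of j] by (simp add: t_def mult.assoc flip: power_add)
    have "x j < t * b ^ (n - f j) * b ^ f j"
      using x unfolding grid_def L[symmetric] by auto
    then have "x j div b ^ f j < t * b ^ (n - f j)"
      using b by (simp add: div_less_iff_less_mult)
    then have "y j div b ^ f j < t * b ^ (n - f j)"
      using y by (simp add: block_def)
    then show ?thesis unfolding L using b by (simp add: div_less_iff_less_mult)
  qed
  then show "y \<in> grid j0 q (b ^ n)" by (simp add: grid_def)
qed

definition lattice_box :: "('d \<Rightarrow> nat) set \<Rightarrow> bool" where
  "lattice_box B \<longleftrightarrow> (\<exists>l r. (\<forall>j. l j \<le> r j) \<and> B = {x. \<forall>j. l j \<le> x j \<and> x j \<le> r j})"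

lemma lattice_box_block:
  assumes b: "0 < b"
  shows "lattice_box (block b f x)"
  unfolding lattice_box_def
proof (intro exI conjI)
  let ?l = "\<lambda>j. x j div b ^ f j * b ^ f j"
  show "\<forall>j. ?l j \<le> ?l j + (b ^ f j - 1)" by simp
  have less: "y < m + c \<longleftrightarrow> y \<le> m + (c - 1)" if "0 < c" for y m c :: nat
    using that by linarith
  show "block b f x = {y. \<forall>j. ?l j \<le> y j \<and> y j \<le> ?l j + (b ^ f j - 1)}"
    using b by (auto simp: block_eq_PiE[OF b] PiE_UNIV_domain less)
qed

text \<open>The sparse selection applied to cells, with \<open>s = b ^ n\<close> and
  \<open>T = h ^ D\<close>. Each shape has \<open>u\<^sup>2 * K\<close> cells in the grid, where
  \<open>K = q * b ^ (n * D) = q * u ^ (6 * D\<^sup>2 * h)\<close>.\<close>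

lemma exists_lattice_boxes:
  defines "D \<equiv> CARD('d::finite) - 1"
  assumes h: "0 < h" "h ^ D \<le> u" and u: "3 \<le> u" and q: "0 < q"
    and \<Delta>: "2 * (q * u\<^sup>2 * u ^ (6 * D * h * (D + 1))) < u ^ \<Delta>"
  obtains A :: "('d::finite \<Rightarrow> nat) set set" and V where
    "\<forall>B\<in>A. lattice_box B \<and> B \<subseteq> V"
    "at_most_pairwise_disjoint (10 * (q * u ^ (6 * D\<^sup>2 * h))) A"
    "\<And>P. finite P \<Longrightarrow> \<forall>B\<in>A. P \<inter> B \<noteq> {} \<Longrightarrow> P \<subseteq> V \<Longrightarrow>
       h ^ D * (q * u ^ (6 * D\<^sup>2 * h)) \<le> card P * \<Delta>"
proof -
  define b where "b = u ^ 6"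
  define n where "n = D * h"
  define j0 :: 'd where "j0 = undefined"
  define V where "V = grid j0 (q * u\<^sup>2) (b ^ n)"
  define E where "E = shapes j0 h n"
  define X where "X = {block b f x |f x. f \<in> E \<and> x \<in> V}"
  have b: "0 < b" using u by (simp add: b_def)
  have cardD: "CARD('d) = D + 1" using zero_less_card_finite[where 'a='d] by (simp add: D_def)
  have sumE: "(\<Sum>j\<in>UNIV. f j) = n" if "f \<in> E" for f
    using that by (simp add: E_def shapes_def)
  have cE: "card E = h ^ D" unfolding E_def D_def by (rule card_shapes) (simp add: n_def D_def)
  have cV: "finite V" "card V = u\<^sup>2 * (q * u ^ (6 * D\<^sup>2 * h)) * b ^ n"
    unfolding V_def by (simp_all add: card_grid cardD b_def n_def power2_eq_square mult_ac flip: power_mult)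
  have "\<exists>A\<subseteq>X. at_most_pairwise_disjoint (10 * (q * u ^ (6 * D\<^sup>2 * h))) A \<and>
    (\<forall>P. finite P \<longrightarrow> (\<forall>B\<in>A. P \<inter> B \<noteq> {}) \<longrightarrow> P \<subseteq> V \<longrightarrow>
       h ^ D * (q * u ^ (6 * D\<^sup>2 * h)) \<le> card P * \<Delta>)"
  proof (rule exists_sparse_subfamily[of V X "b ^ n" "h ^ D" u "q * u ^ (6 * D\<^sup>2 * h)" \<Delta>])
    show "B \<subseteq> V" if B: "B \<in> X" for B
    proof -
      obtain f x where B: "B = block b f x" "f \<in> E" "x \<in> V" using B by (auto simp: X_def)
      have "f j \<le> n" for j
        using sumE[OF B(2)] by (metis UNIV_I finite member_le_sum zero_le)
      then show ?thesis using B b by (simp add: V_def block_subset_grid)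
    qed
    show "card B = b ^ n" if "B \<in> X" for B
      using that b by (auto simp: X_def card_block sumE)
    show "card {B\<in>X. x \<in> B} = h ^ D" if x: "x \<in> V" for x
    proof -
      have "{B\<in>X. x \<in> B} = (\<lambda>f. block b f x) ` E"
      proof
        show "{B\<in>X. x \<in> B} \<subseteq> (\<lambda>f. block b f x) ` E"
          using block_eqI by (fastforce simp: X_def)
        show "(\<lambda>f. block b f x) ` E \<subseteq> {B\<in>X. x \<in> B}"
          using x by (auto simp: X_def mem_block)
      qed
      \<comment> \<open>If two shapes gave the same cell at \<open>x\<close>, that cell would be the
        intersection, and \<open>card_block_Int\<close> with \<open>f \<noteq> g\<close> would yield
        \<open>b * b ^ n \<le> b ^ n\<close>.\<close>
      moreover have "inj_on (\<lambda>f. block b f x) E"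
      proof (rule inj_onI, rule ccontr)
        fix f g assume fg: "f \<in> E" "g \<in> E" and eq: "block b f x = block b g x" and "f \<noteq> g"
        then have "b * b ^ n \<le> b ^ n"
          using card_block_Int[OF b sumE[OF fg(1)] sumE[OF fg(2)], of x x] card_block(2)[OF b, of g x]
          by (simp add: sumE)
        moreover have "1 < b" using u unfolding b_def by (intro one_less_power) auto
        ultimately show False using b by simp
      qed
      ultimately show ?thesis by (simp add: card_image cE)
    qed
    show "u ^ 6 * card (B \<inter> C) \<le> b ^ n" if BC: "B \<in> X" "C \<in> X" "B \<noteq> C" for B C
    proof -
      obtain f x g y where fg: "B = block b f x" "f \<in> E" "C = block b g y" "g \<in> E"
        using BC(1,2) unfolding X_def by blast
      show ?thesis
        unfolding b_def[symmetric] fg(1,3)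
        by (rule card_block_Int[OF b sumE[OF fg(2)] sumE[OF fg(4)]]) (use BC(3) fg in auto)
    qed
    show "2 * card V < u ^ \<Delta>"
    proof -
      have "card V = q * u\<^sup>2 * u ^ (6 * D * h * (D + 1))"
        unfolding V_def by (simp add: card_grid cardD b_def n_def power2_eq_square algebra_simps flip: power_mult power_add)
      then show ?thesis using \<Delta> by simp
    qed
  qed (use cV h u q b in auto)
  then obtain A where A: "A \<subseteq> X" "at_most_pairwise_disjoint (10 * (q * u ^ (6 * D\<^sup>2 * h))) A"
    "\<And>P. finite P \<Longrightarrow> \<forall>B\<in>A. P \<inter> B \<noteq> {} \<Longrightarrow> P \<subseteq> V \<Longrightarrow>
       h ^ D * (q * u ^ (6 * D\<^sup>2 * h)) \<le> card P * \<Delta>" by blast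
  have "B \<subseteq> V \<and> lattice_box B" if BX: "B \<in> X" for B
  proof -
    obtain f x where B: "B = block b f x" "f \<in> E" "x \<in> V" using BX by (auto simp: X_def)
    have "f j \<le> n" for j
      using sumE[OF B(2)] by (metis UNIV_I finite member_le_sum zero_le)
    then show ?thesis using B b by (simp add: V_def block_subset_grid lattice_box_block)
  qed
  then show thesis using A by (intro that[of A V]) auto
qed

section \<open>From lattice boxes to boxes in real space\<close>

lemma at_most_pairwise_disjoint_mono:
  "at_most_pairwise_disjoint k F \<Longrightarrow> k \<le> l \<Longrightarrow> at_most_pairwise_disjoint l F"
  unfolding at_most_pairwise_disjoint_def using le_trans by blast

text \<open>A lattice box becomes the real box with the same corners, whose lattice points are the
  original box. Disjointness thus passes to the lattice, and so does piercing: rounding coordinates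
  down stays inside a box with integer corners.\<close>

lemma real_boxes_of_lattice_boxes:
  fixes A :: "('d::finite \<Rightarrow> nat) set set"
  assumes A: "\<forall>B\<in>A. lattice_box B \<and> B \<subseteq> V" and dis: "at_most_pairwise_disjoint k A"
    and pierce: "\<And>P. finite P \<Longrightarrow> \<forall>B\<in>A. P \<inter> B \<noteq> {} \<Longrightarrow> P \<subseteq> V \<Longrightarrow> N \<le> card P * \<Delta>"
  obtains F :: "(real ^ 'd) set set" where "\<forall>B\<in>F. axis_parallel_box B" "at_most_pairwise_disjoint k F"
    "\<And>P. finite P \<Longrightarrow> \<forall>B\<in>F. P \<inter> B \<noteq> {} \<Longrightarrow> N \<le> card P * \<Delta>"
proof -
  let ?e = "\<lambda>x :: 'd \<Rightarrow> nat. (\<chi> j. real (x j)) :: real ^ 'd"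
  let ?lb = "\<lambda>l r. {x. \<forall>j. l j \<le> x j \<and> x j \<le> r j} :: ('d \<Rightarrow> nat) set"
  let ?ok = "\<lambda>l r. (\<forall>j. l j \<le> r j) \<and> ?lb l r \<in> A"
  define F where "F = {cbox (?e l) (?e r) |l r. ?ok l r}"
  have pre: "?e -` cbox (?e l) (?e r) = ?lb l r" for l r
    by (auto simp: mem_box_cart)
  show thesis
  proof
    show "\<forall>B\<in>F. axis_parallel_box B"
    proof
      fix B assume "B \<in> F"
      then obtain l r where lr: "B = cbox (?e l) (?e r)" "\<forall>j. l j \<le> r j" by (auto simp: F_def)
      then have "\<forall>j. ?e l $ j \<le> ?e r $ j" by simp
      then show "axis_parallel_box B" using lr(1) unfolding axis_parallel_box_def by blast
    qed
    show "at_most_pairwise_disjoint k F"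
      unfolding at_most_pairwise_disjoint_def
    proof (intro allI impI)
      fix G assume G: "G \<subseteq> F" "pairwise disjnt G"
      have in_A: "?e -` B \<in> A \<and> ?e -` B \<noteq> {}" if B: "B \<in> G" for B
      proof -
        obtain l r where lr: "B = cbox (?e l) (?e r)" "?ok l r"
          using B G(1) unfolding F_def by blast
        then have "l \<in> ?lb l r" by auto
        then show ?thesis using lr pre by auto
      qed
      \<comment> \<open>Distinct boxes of \<open>G\<close> are disjoint, so a common nonempty trace
        on the lattice forces equality; hence passing to traces keeps the cardinality.\<close>
      have inj: "inj_on ((-`) ?e) G"
      proof (rule inj_onI)
        fix B C assume BC: "B \<in> G" "C \<in> G" "?e -` B = ?e -` C"
        then have "\<not> disjnt B C" using in_A[of B] by (auto simp: disjnt_def)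
        then show "B = C" using G(2) BC by (auto simp: pairwise_def)
      qed
      have "pairwise disjnt ((-`) ?e ` G)"
        using G(2) by (auto simp: pairwise_def disjnt_def)
      then have "finite ((-`) ?e ` G) \<and> card ((-`) ?e ` G) \<le> k"
        using dis in_A unfolding at_most_pairwise_disjoint_def by blast
      then show "finite G \<and> card G \<le> k"
        using inj by (simp add: finite_image_iff card_image)
    qed
    fix P :: "(real ^ 'd) set" assume P: "finite P" "\<forall>B\<in>F. P \<inter> B \<noteq> {}"
    \<comment> \<open>Negative coordinates go to 0, which is harmless: a point lying in a box of
      \<open>F\<close> has none.\<close>
    let ?fl = "\<lambda>y :: real ^ 'd. \<lambda>j. nat \<lfloor>y $ j\<rfloor>"
    have "N \<le> card (?fl ` P \<inter> V) * \<Delta>"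
    proof (rule pierce)
      show "\<forall>B\<in>A. ?fl ` P \<inter> V \<inter> B \<noteq> {}"
      proof
        fix B assume B: "B \<in> A"
        then obtain l r where lr: "\<forall>j. l j \<le> r j" "B = ?lb l r"
          using A by (auto simp: lattice_box_def)
        then have "cbox (?e l) (?e r) \<in> F" using B by (auto simp: F_def)
        then obtain y where y: "y \<in> P" "y \<in> cbox (?e l) (?e r)" using P(2) by blast
        have "l j \<le> ?fl y j \<and> ?fl y j \<le> r j" for j
        proof -
          have "real (l j) \<le> y $ j" "y $ j \<le> real (r j)" using y(2) by (auto simp: mem_box_cart)
          then show ?thesis by (auto simp: le_nat_floor) linarith
        qed
        then have "?fl y \<in> B" using lr by simp
        then show "?fl ` P \<inter> V \<inter> B \<noteq> {}" using y(1) A B by blast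
      qed
    qed (use P in auto)
    also have "\<dots> \<le> card P * \<Delta>"
      using P(1) by (intro mult_right_mono order.trans[OF card_mono card_image_le]) auto
    finally show "N \<le> card P * \<Delta>" .
  qed
qed

text \<open>Without a finite piercing set the infimum is \<open>\<infinity>\<close>; otherwise it is
  attained, because \<open>enat\<close> is well-ordered.\<close>

lemma le_piercing_numberI:
  assumes "\<And>P. finite P \<Longrightarrow> \<forall>B\<in>F. P \<inter> B \<noteq> {} \<Longrightarrow> c \<le> real (card P)"
  shows "ereal c \<le> ereal_of_enat (piercing_number F)"
proof (cases "{P. finite P \<and> (\<forall>B\<in>F. P \<inter> B \<noteq> {})} = {}")
  case True
  then have "piercing_number F = \<infinity>"
    unfolding piercing_number_def True by (simp add: top_enat_def)
  then show ?thesis by simp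
next
  case False
  then have "piercing_number F \<in> (\<lambda>P. enat (card P)) ` {P. finite P \<and> (\<forall>B\<in>F. P \<inter> B \<noteq> {})}"
    unfolding piercing_number_def by (metis (no_types, lifting) equals0I imageI wellorder_InfI)
  then show ?thesis using assms by auto
qed

section \<open>Choice of parameters\<close>

text \<open>In the bound \<open>h ^ D * (q * M) / \<Delta>\<close>, both \<open>h\<close> and
  \<open>\<Delta>\<close> have order \<open>\<rho>\<close> and \<open>q * M\<close> has order
  \<open>k\<close>. The constant collects \<open>h \<ge> \<rho> / (24 * D ^ 3)\<close>,
  \<open>q * M \<ge> k / 20\<close> and \<open>\<Delta> \<le> 4 * \<rho>\<close>.\<close>

lemma exists_boxes_large:
  fixes k :: nat
  defines "D \<equiv> CARD('d::finite) - 1" and "\<rho> \<equiv> ln (real k) / ln (ln (real k))"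
  assumes D: "0 < D" and k: "100 \<le> k" "4 \<le> ln (real k)" and \<rho>: "12 * real D ^ 3 \<le> \<rho>" "4 \<le> \<rho>"
  obtains F :: "(real ^ 'd) set set" where "\<forall>B\<in>F. axis_parallel_box B" "at_most_pairwise_disjoint k F"
    "\<And>P. finite P \<Longrightarrow> \<forall>B\<in>F. P \<inter> B \<noteq> {} \<Longrightarrow>
       1 / (80 * (24 * real D ^ 3) ^ D) * real k * \<rho> ^ (D - 1) \<le> real (card P)"
proof -
  define l where "l = ln (real k)"
  \<comment> \<open>About \<open>ln k\<close>; then \<open>u = w ^ D\<close> ensures
    \<open>h ^ D \<le> u\<close> as soon as \<open>h \<le> w\<close>.\<close>
  define w where "w = nat \<lfloor>l\<rfloor>"
  define u where "u = w ^ D"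
  \<comment> \<open>The divisor is chosen so that \<open>M = w ^ (6 * D ^ 3 * h)\<close> satisfies
    \<open>ln M \<le> l / 2\<close>, that is, \<open>M \<le> sqrt k\<close>.\<close>
  define y where "y = \<rho> / (12 * real D ^ 3)"
  define h where "h = nat \<lfloor>y\<rfloor>"
  \<comment> \<open>Since \<open>ln w \<ge> ln l / 2\<close>, an exponent of at least
    \<open>2 * \<rho>\<close> brings \<open>w\<close>, and hence \<open>u\<close>, up to
    \<open>k\<close>.\<close>
  define e where "e = nat \<lceil>2 * \<rho>\<rceil>"
  define M where "M = u ^ (6 * D\<^sup>2 * h)"
  \<comment> \<open>Rounding down keeps \<open>10 * (q * M) \<le> k\<close> and loses at most half
    of \<open>k\<close>, as \<open>q\<close> is positive.\<close>
  define q where "q = k div (10 * M)"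
  \<comment> \<open>The first summand is the exponent of \<open>u\<close> in the unstretched grid,
    \<open>e\<close> pays for \<open>q\<close>, and 3 pays for \<open>u\<^sup>2\<close> and the
    factor 2.\<close>
  define \<Delta> where "\<Delta> = 6 * D * h * (D + 1) + 3 + e"
  have l4: "4 \<le> l" using k by (simp add: l_def)
  have D3: "1 \<le> real D ^ 3" using D by (intro one_le_power) simp
  have lnl: "1 \<le> ln l"
  proof -
    have "exp 1 \<le> l" using l4 exp_le by linarith
    then show ?thesis using l4 by (subst ln_ge_iff) auto
  qed
  have \<rho>l: "\<rho> * ln l = l" using lnl by (simp add: \<rho>_def l_def)
  have w: "real w \<le> l" "l - 1 \<le> real w" "4 \<le> w"
  proof -
    show "real w \<le> l" "l - 1 \<le> real w" using l4 unfolding w_def by linarith+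
    show "4 \<le> w" using l4 unfolding w_def by (simp add: le_nat_floor)
  qed
  have u: "w \<le> u"
    using w(3) D power_increasing[of 1 D w] by (simp add: u_def)
  have y1: "1 \<le> y" using \<rho>(1) D3 unfolding y_def by (subst le_divide_eq_1_pos) linarith+
  have h: "real h \<le> y" "y / 2 \<le> real h" "0 < h"
  proof -
    show "real h \<le> y" using y1 unfolding h_def by linarith
    show "0 < h" using y1 unfolding h_def by simp
    have "y < real h + 1" using y1 unfolding h_def by linarith
    moreover have "1 \<le> real h" using \<open>0 < h\<close> by simp
    ultimately show "y / 2 \<le> real h" by linarith
  qed
  have h_le_w: "h \<le> w"
  proof -
    have "\<rho> * 1 \<le> \<rho> * ln l" using lnl \<rho> by (intro mult_left_mono) auto
    then have "\<rho> \<le> l" using \<rho>l by simp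
    moreover have "y \<le> \<rho>"
    proof -
      have "\<rho> * 1 \<le> \<rho> * (12 * real D ^ 3)" using \<rho> D3 by (intro mult_left_mono) auto
      then show ?thesis using D by (simp add: y_def divide_le_eq)
    qed
    ultimately have "y \<le> l" by simp
    then show ?thesis unfolding h_def w_def by (intro nat_mono floor_mono)
  qed
  have M0: "0 < M" using u w(3) by (simp add: M_def)
  have M_le: "10 * real M \<le> real k"
  proof -
    have "real M = real w ^ (6 * D ^ 3 * h)"
      by (simp add: M_def u_def power2_eq_square power3_eq_cube mult_ac flip: power_mult)
    then have "ln (real M) = 6 * real D ^ 3 * h * ln w"
      using w(3) by (simp add: ln_realpow)
    also have "\<dots> \<le> 6 * real D ^ 3 * y * ln l"
      using w h y1 lnl l4 by (intro mult_mono) auto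
    also have "\<dots> = l / 2" using D \<rho>l by (simp add: y_def field_simps)
    finally have "exp (ln (real M)) \<le> exp (l / 2)" by simp
    then have "real M \<le> exp (l / 2)" using M0 by simp
    also have "exp (l / 2) = sqrt (real k)"
    proof -
      have "exp (l / 2) ^ 2 = exp l" by (simp flip: exp_of_nat_mult)
      also have "\<dots> = real k" using k(1) by (simp add: l_def)
      finally show ?thesis by (metis exp_ge_zero real_sqrt_unique)
    qed
    finally have "real M \<le> sqrt (real k)" .
    moreover have "10 \<le> sqrt (real k)" using k(1) by (intro real_le_rsqrt) simp
    ultimately have "10 * real M \<le> sqrt (real k) * sqrt (real k)"
      by (intro mult_mono) auto
    then show ?thesis by simp
  qed
  have q: "0 < q" "10 * (q * M) \<le> k" "k \<le> 20 * (q * M)"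
  proof -
    have "10 * M \<le> k" using M_le by linarith
    then show q0: "0 < q" using M0 by (simp add: q_def div_greater_zero_iff)
    show "10 * (q * M) \<le> k"
      using div_times_less_eq_dividend[of k "10 * M"] by (simp add: q_def mult_ac)
    have "k < q * (10 * M) + 10 * M"
      using dividend_less_div_times[of "10 * M" k] M0 by (simp add: q_def)
    moreover have "1 * M \<le> q * M" using q0 by (intro mult_right_mono) auto
    moreover have "q * (10 * M) = 10 * (q * M)" by simp
    ultimately show "k \<le> 20 * (q * M)" by linarith
  qed
  have k_le: "k \<le> u ^ e"
  proof -
    have "sqrt l \<le> real w"
    proof -
      have "sqrt l * 2 \<le> sqrt l * sqrt l"
        using l4 by (intro mult_left_mono) (auto intro: real_le_rsqrt)
      then have "2 * sqrt l \<le> l" using l4 by simp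
      then show ?thesis using w(2) l4 by linarith
    qed
    then have "ln (sqrt l) \<le> ln w" using l4 w(3) by (subst ln_le_cancel_iff) auto
    then have lnw: "ln l / 2 \<le> ln w" using l4 by (simp add: ln_sqrt)
    have "2 * \<rho> \<le> real e" unfolding e_def by linarith
    then have "2 * \<rho> * (ln l / 2) \<le> real e * ln w"
      using lnw lnl \<rho> by (intro mult_mono) auto
    then have "ln (real k) \<le> ln (real w ^ e)"
      using \<rho>l w(3) by (simp add: ln_realpow flip: l_def)
    then have "real k \<le> real w ^ e"
      using k(1) w(3) by (subst (asm) ln_le_cancel_iff) auto
    also have "\<dots> \<le> real u ^ e" using u by (intro power_mono) auto
    finally show ?thesis by (metis of_nat_le_iff of_nat_power)
  qed
  have small: "2 * (q * u\<^sup>2 * u ^ (6 * D * h * (D + 1))) < u ^ \<Delta>"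
  proof -
    have "q \<le> u ^ e" unfolding q_def by (rule le_trans[OF div_le_dividend k_le])
    moreover have "2 < u" using u w(3) by linarith
    moreover have "0 < u ^ e" using k_le k(1) by linarith
    ultimately have "2 * q < u * u ^ e" by (intro mult_less_le_imp_less) (use q in auto)
    then have "2 * q * (u\<^sup>2 * u ^ (6 * D * h * (D + 1))) < u * u ^ e * (u\<^sup>2 * u ^ (6 * D * h * (D + 1)))"
      using \<open>2 < u\<close> by (intro mult_strict_right_mono) auto
    also have "\<dots> = u ^ \<Delta>"
      by (simp add: \<Delta>_def power_add power2_eq_square power3_eq_cube)
    finally show ?thesis by simp
  qed
  have \<Delta>_le: "real \<Delta> \<le> 4 * \<rho>"
  proof -
    have "real (6 * D * h * (D + 1)) = 6 * real D * (real D + 1) * real h"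
      by (simp add: algebra_simps)
    also have "\<dots> \<le> 6 * real D * (2 * real D) * y"
      using D h y1 by (intro mult_mono) auto
    also have "\<dots> = \<rho> / real D" using D by (simp add: y_def power3_eq_cube)
    also have "\<dots> \<le> \<rho> / 1" using D \<rho> by (intro divide_left_mono) auto
    finally have "real (6 * D * h * (D + 1)) \<le> \<rho>" by simp
    moreover have "real e \<le> 2 * \<rho> + 1" using \<rho> unfolding e_def by linarith
    ultimately show ?thesis using \<rho>(2) unfolding \<Delta>_def by simp
  qed
  have hu: "h ^ D \<le> u" unfolding u_def using h_le_w by (intro power_mono) auto
  have u3: "3 \<le> u" using u w(3) by linarith
  obtain A :: "('d \<Rightarrow> nat) set set" and V where A:
    "\<forall>B\<in>A. lattice_box B \<and> B \<subseteq> V" "at_most_pairwise_disjoint (10 * (q * M)) A"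
    "\<And>P. finite P \<Longrightarrow> \<forall>B\<in>A. P \<inter> B \<noteq> {} \<Longrightarrow> P \<subseteq> V \<Longrightarrow> h ^ D * (q * M) \<le> card P * \<Delta>"
    using exists_lattice_boxes[where 'd = 'd, folded D_def, OF h(3) hu u3 q(1) small, folded M_def]
    by blast
  obtain F :: "(real ^ 'd) set set" where F:
    "\<forall>B\<in>F. axis_parallel_box B" "at_most_pairwise_disjoint (10 * (q * M)) F"
    "\<And>P. finite P \<Longrightarrow> \<forall>B\<in>F. P \<inter> B \<noteq> {} \<Longrightarrow> h ^ D * (q * M) \<le> card P * \<Delta>"
    using real_boxes_of_lattice_boxes[OF A] by blast
  show thesis
  proof
    show "at_most_pairwise_disjoint k F" using F(2) q(2) by (rule at_most_pairwise_disjoint_mono)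
    fix P assume P: "finite P" "\<forall>B\<in>F. P \<inter> B \<noteq> {}"
    have "(\<rho> / (24 * real D ^ 3)) ^ D * (real k / 20) \<le> real h ^ D * (real q * real M)"
    proof (intro mult_mono power_mono)
      show "\<rho> / (24 * real D ^ 3) \<le> real h" using h(2) by (simp add: y_def)
      have "real k \<le> real (20 * (q * M))" using q(3) by (rule of_nat_mono)
      then show "real k / 20 \<le> real q * real M" by simp
    qed (use \<rho> in auto)
    also have "\<dots> \<le> real (card P) * real \<Delta>"
      using of_nat_mono[OF F(3)[OF P], where 'a = real] by simp
    also have "\<dots> \<le> real (card P) * (4 * \<rho>)"
      using \<Delta>_le by (intro mult_left_mono) auto
    finally have "(\<rho> / (24 * real D ^ 3)) ^ D * (real k / 20) / (4 * \<rho>) \<le> real (card P)"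
      using \<rho> by (simp add: divide_le_eq)
    also have "(\<rho> / (24 * real D ^ 3)) ^ D * (real k / 20) / (4 * \<rho>)
        = 1 / (80 * (24 * real D ^ 3) ^ D) * real k * \<rho> ^ (D - 1)"
    proof -
      have "\<rho> ^ D = \<rho> * \<rho> ^ (D - 1)" using D by (simp flip: power_Suc)
      then show ?thesis using \<rho> by (simp add: power_divide)
    qed
    finally show "1 / (80 * (24 * real D ^ 3) ^ D) * real k * \<rho> ^ (D - 1) \<le> real (card P)" .
  qed (rule F)
qed

text \<open>Serves the small \<open>k\<close>: distinct one-point boxes on the diagonal need one
  piercing point each.\<close>

lemma exists_disjoint_boxes:
  obtains F :: "(real ^ 'd::finite) set set" where "\<forall>B\<in>F. axis_parallel_box B" "at_most_pairwise_disjoint k F"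
    "\<And>P. finite P \<Longrightarrow> \<forall>B\<in>F. P \<inter> B \<noteq> {} \<Longrightarrow> k \<le> card P"
proof
  let ?e = "\<lambda>i :: nat. (\<chi> j. real i) :: real ^ 'd"
  let ?F = "(\<lambda>i. {?e i}) ` {..<k}"
  have inj: "inj ?e" by (auto simp: inj_def vec_eq_iff)
  show "\<forall>B\<in>?F. axis_parallel_box B"
    unfolding axis_parallel_box_def by (metis (no_types, lifting) cbox_idem imageE order_refl)
  show "at_most_pairwise_disjoint k ?F"
    unfolding at_most_pairwise_disjoint_def
  proof (intro allI impI)
    fix G assume G: "G \<subseteq> ?F"
    then have "card G \<le> card ?F" by (intro card_mono) auto
    also have "\<dots> \<le> k" using card_image_le[of "{..<k}" "\<lambda>i. {?e i}"] by simp
    finally show "finite G \<and> card G \<le> k" using G finite_subset by blast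
  qed
  fix P assume P: "finite P" "\<forall>B\<in>?F. P \<inter> B \<noteq> {}"
  then have "?e ` {..<k} \<subseteq> P" by auto
  then have "card (?e ` {..<k}) \<le> card P" using P by (intro card_mono)
  then show "k \<le> card P" using inj by (simp add: card_image inj_on_subset)
qed

theorem theorem1:
  assumes "CARD('d::finite) \<ge> 3"
  shows "\<exists>c::real. c > 0 \<and>
    (\<forall>k::nat. k > 0 \<longrightarrow>
      (\<exists>F :: (real ^ 'd) set set.
         (\<forall>B\<in>F. axis_parallel_box B) \<and>
         at_most_pairwise_disjoint k F \<and>
         ereal (c * real k * (ln (real k) / ln (ln (real k))) ^ (CARD('d) - 2))
           \<le> ereal_of_enat (piercing_number F)))"
proof -
  define D where "D = CARD('d) - 1"
  have D: "0 < D" "CARD('d) - 2 = D - 1" using assms by (simp_all add: D_def)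
  define \<rho> where "\<rho> = (\<lambda>k. ln (real k) / ln (ln (real k)))"
  have "eventually (\<lambda>k::nat. 4 \<le> ln (real k)) at_top"
    "filterlim \<rho> at_top at_top" unfolding \<rho>_def by real_asymp+
  then have "eventually (\<lambda>k. 100 \<le> k \<and> 4 \<le> ln (real k) \<and> 12 * real D ^ 3 \<le> \<rho> k \<and> 4 \<le> \<rho> k) at_top"
    by (intro eventually_conj eventually_ge_at_top) (auto simp: filterlim_at_top)
  then obtain k0 where k0: "\<And>k. k0 \<le> k \<Longrightarrow>
      100 \<le> k \<and> 4 \<le> ln (real k) \<and> 12 * real D ^ 3 \<le> \<rho> k \<and> 4 \<le> \<rho> k"
    by (auto simp: eventually_at_top_linorder)
  define c1 where "c1 = 1 / (80 * (24 * real D ^ 3) ^ D)"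
  \<comment> \<open>For the finitely many \<open>k < k0\<close>, where the quotient may be negative
    or a default value, \<open>c \<le> 1 / S\<close> pushes the required bound down to at most
    \<open>k\<close>; the summand 1 keeps \<open>S\<close> positive.\<close>
  define S where "S = 1 + (\<Sum>k<k0. \<bar>\<rho> k ^ (D - 1)\<bar>)"
  have S: "1 \<le> S" unfolding S_def by (simp add: sum_nonneg)
  define c where "c = min c1 (1 / S)"
  have c1: "0 < c1" using D by (simp add: c1_def)
  have c: "0 < c" "c \<le> c1" "c * S \<le> 1"
    using S c1 by (auto simp: c_def min_def field_simps)
  have "\<exists>F :: (real ^ 'd) set set. (\<forall>B\<in>F. axis_parallel_box B) \<and> at_most_pairwise_disjoint k F \<and>
      (\<forall>P. finite P \<longrightarrow> (\<forall>B\<in>F. P \<inter> B \<noteq> {}) \<longrightarrow> c * real k * \<rho> k ^ (D - 1) \<le> real (card P))" for k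
  proof (cases "k0 \<le> k")
    case True
    note k = k0[OF True]
    obtain F :: "(real ^ 'd) set set" where F: "\<forall>B\<in>F. axis_parallel_box B" "at_most_pairwise_disjoint k F"
      "\<And>P. finite P \<Longrightarrow> \<forall>B\<in>F. P \<inter> B \<noteq> {} \<Longrightarrow> c1 * real k * \<rho> k ^ (D - 1) \<le> real (card P)"
      using exists_boxes_large[of k, where 'd = 'd, folded D_def] D k
      unfolding c1_def \<rho>_def by blast
    have "c * real k * \<rho> k ^ (D - 1) \<le> c1 * real k * \<rho> k ^ (D - 1)"
      using c k by (intro mult_right_mono) auto
    then show ?thesis using F by (intro exI[of _ F]) (auto intro: order.trans)
  next
    case False
    obtain F :: "(real ^ 'd) set set" where F: "\<forall>B\<in>F. axis_parallel_box B" "at_most_pairwise_disjoint k F"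
      "\<And>P. finite P \<Longrightarrow> \<forall>B\<in>F. P \<inter> B \<noteq> {} \<Longrightarrow> k \<le> card P"
      using exists_disjoint_boxes[where 'd = 'd and k = k] by blast
    have "\<rho> k ^ (D - 1) \<le> \<bar>\<rho> k ^ (D - 1)\<bar>" by simp
    also have "\<dots> \<le> (\<Sum>k<k0. \<bar>\<rho> k ^ (D - 1)\<bar>)"
      using False by (intro member_le_sum) auto
    also have "\<dots> \<le> S" by (simp add: S_def)
    finally have "c * \<rho> k ^ (D - 1) \<le> c * S" using c by (intro mult_left_mono) auto
    then have "c * \<rho> k ^ (D - 1) \<le> 1" using c(3) by linarith
    then have "real k * (c * \<rho> k ^ (D - 1)) \<le> real k * 1" by (intro mult_left_mono) auto
    then have "c * real k * \<rho> k ^ (D - 1) \<le> real k" by (simp add: mult_ac)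
    then show ?thesis using F by (intro exI[of _ F]) (auto intro: order.trans)
  qed
  then have "\<exists>F :: (real ^ 'd) set set. (\<forall>B\<in>F. axis_parallel_box B) \<and> at_most_pairwise_disjoint k F \<and>
      ereal (c * real k * \<rho> k ^ (D - 1)) \<le> ereal_of_enat (piercing_number F)" for k
    using le_piercing_numberI by metis
  then show ?thesis
    unfolding D(2) using c(1) by (auto simp: \<rho>_def)
qed

end
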